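(* Let $q>1$, $A\in\mathbb{R}$ and $\mathbf{p}_0=(1,0)$. Consider $$\inf_{\gamma\in\mathcal{S}_{A,\mathbf{p}_0}}E(\gamma),\qquad E(\gamma)=\int_0^1|\gamma|^q|\gamma'|\,dt .$$ Then this infimum equals the infimum $\frac{1}{1+q}$ of the unconstrained problem (the infimum of $E$ over all locally Lipschitz curves from $\mathbf{p}_0$ to the origin), and it is not attained: there is no minimizer of $E$ in $\mathcal{S}_{A,\mathbf{p}_0}$.
   Context: For a locally Lipschitz curve $\gamma=(\gamma^{(1)},\gamma^{(2)}):[0,1]\to\mathbb{R}^2$, $\mathcal{P}(\gamma)=-\int_0^1\gamma^{(2)}(\gamma^{(1)})'\,dt$. $\mathcal{S}_{A,\mathbf{p}_0}$ is the set of all locally Lipschitz $\gamma:[0,1]\to\mathbb{R}^2$ with $\gamma(0)=\mathbf{p}_0$, $\gamma(1)=(0,0)$ and $\mathcal{P}(\gamma)=A$. The functional $E$ is length in the metric with conformal factor $F=\sqrt{W}$, where $W(p)=|p|^{q'}$ with $q'=2q>2$.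
   Formalization: The non-existence of a minimizer is stated only for A ≠ 0, since for A = 0 the segment (1-t, 0) lies in the constrained class and attains 1/(1+q); the equality of the infima is stated for every real A. *)

theory Defs
  imports "HOL-Analysis.Analysis"
begin

text \<open>
  A curve [0,1] \<rightarrow> R^2 is a function on all of \<^typ>\<open>real\<close> of which only the values on
  [0,1] matter: every notion below depends only on that restriction (derivatives are taken
  within [0,1]).  The norm on \<^typ>\<open>real \<times> real\<close> is the Euclidean one.
\<close>

text \<open>
  The library's \<^const>\<open>local_lipschitz\<close> is about families of functions; the parameter is
  a dummy here.
\<close>

definition locally_lipschitz_on :: "real set \<Rightarrow> (real \<Rightarrow> real \<times> real) \<Rightarrow> bool" where
  "locally_lipschitz_on X \<gamma> \<longleftrightarrow> local_lipschitz {0 :: real} X (\<lambda>_. \<gamma>)"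

lemma locally_lipschitz_on_iff:
  "locally_lipschitz_on X \<gamma> \<longleftrightarrow>
    (\<forall>t\<in>X. \<exists>u>0. \<exists>L. L-lipschitz_on (cball t u \<inter> X) \<gamma>)"
  by (force simp: locally_lipschitz_on_def local_lipschitz_def)

text \<open>
  A locally Lipschitz curve is differentiable almost everywhere on [0,1], so the value that
  \<^const>\<open>vector_derivative\<close> takes at the other points does not affect the integrals
  below.  The integrands are then bounded and Lebesgue measurable.
\<close>

definition area_functional :: "(real \<Rightarrow> real \<times> real) \<Rightarrow> real" where
  "area_functional \<gamma> =
    - (LINT t:{0..1}|lebesgue.
         snd (\<gamma> t) * vector_derivative (\<lambda>s. fst (\<gamma> s)) (at t within {0..1}))"

definition weighted_length :: "real \<Rightarrow> (real \<Rightarrow> real \<times> real) \<Rightarrow> real" where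
  "weighted_length q \<gamma> =
    (LINT t:{0..1}|lebesgue.
       norm (\<gamma> t) powr q * norm (vector_derivative \<gamma> (at t within {0..1})))"

definition curves_to_origin :: "real \<times> real \<Rightarrow> (real \<Rightarrow> real \<times> real) set" where
  "curves_to_origin p =
    {\<gamma>. locally_lipschitz_on {0..1} \<gamma> \<and> \<gamma> 0 = p \<and> \<gamma> 1 = (0, 0)}"

definition constrained_curves :: "real \<Rightarrow> real \<times> real \<Rightarrow> (real \<Rightarrow> real \<times> real) set" where
  "constrained_curves A p = {\<gamma> \<in> curves_to_origin p. area_functional \<gamma> = A}"

end

theory Submission
  imports Defs
begin

text \<open>
  The radial function \<open>|p|^(q+1) / (q+1)\<close> has gradient \<open>|p|^(q-1) p\<close>, whose norm is the weight
  \<open>|p|^q\<close>. Along a Lipschitz curve it therefore changes at most as fast as weighted length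
  accumulates, so every curve from \<open>(1,0)\<close> to the origin has weighted length at least
  \<open>1/(1+q)\<close> (\<open>weighted_length_ge\<close>). The excess is the integral of a pointwise nonnegative
  defect. If it vanishes, Cauchy--Schwarz is an equality at almost every time, hence the velocity
  points to the origin: the distance to the origin never increases, and the direction \<open>\<gamma>/|\<gamma>|\<close>
  is constant until the origin is reached for good (\<open>weighted_length_eq_imp_radial\<close>). Such a
  curve stays on the segment and has area 0, so no curve of area \<open>A \<noteq> 0\<close> has length exactly
  \<open>1/(1+q)\<close>.

  Area, on the other hand, is almost free near the origin. Following the segment by \<open>n\<close> turns
  around a circle of radius \<open>\<rho>\<close> through the origin gives area \<open>\<plusminus>\<pi> n \<rho>\<^sup>2\<close> at a cost of order
  \<open>n \<rho>^(q+1)\<close>. With the area fixed this is of order \<open>\<rho>^(q-1)\<close>, which tends to 0 because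
  \<open>q > 1\<close> (\<open>cheap_curve_with_area\<close>). So both infima equal \<open>1/(1+q)\<close>.

  The lower bound needs that a Lipschitz curve is differentiable almost everywhere and is the
  integral of its derivative (\<open>lipschitz_FTC\<close>). A density for the increments of a real Lipschitz
  function comes from the Radon--Nikodym theorem, and Lebesgue's theorem on averages of an
  integrable function identifies this density with the derivative almost everywhere.
\<close>

section \<open>Lipschitz functions are integrals of their derivatives\<close>

text \<open>
  Adding a steep linear term makes \<open>f\<close> an increasing homeomorphism \<open>F\<close>. The image of
  Lebesgue measure under the inverse of \<open>F\<close> assigns to an interval the increment of \<open>F\<close>. It is
  absolutely continuous because the Lipschitz map \<open>F\<close> sends null sets to null sets, so it has a
  density.
\<close>

lemma lipschitz_real_primitive:
  fixes f :: "real \<Rightarrow> real"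
  assumes lip: "L-lipschitz_on UNIV f"
  obtains h where "\<And>a b. a \<le> b \<Longrightarrow> (h has_integral (f b - f a)) {a..b}"
proof -
  define F where "F x = (L + 1) * x + f x" for x
  have L0: "0 \<le> L" using lip by (rule lipschitz_on_nonneg)
  have fdist: "\<bar>f x - f y\<bar> \<le> L * \<bar>x - y\<bar>" for x y
    using lipschitz_onD[OF lip, of x y] by (simp add: dist_real_def)
  have grow: "y - x \<le> F y - F x" if "x \<le> y" for x y
    using fdist[of x y] that unfolding F_def by (auto simp: algebra_simps abs_if split: if_splits)
  have contF: "continuous_on UNIV F"
    unfolding F_def using lip by (intro continuous_intros lipschitz_on_continuous_on)
  have surjF: "\<exists>x. F x = y" for y
  proof -
    define u where "u = \<bar>y - F 0\<bar>"
    have "F (- u) \<le> y" "y \<le> F u"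
      using grow[of "- u" 0] grow[of 0 u] by (auto simp: u_def)
    moreover have "- u \<le> u" by (simp add: u_def)
    ultimately show ?thesis
      using IVT'[of F "- u" y u] continuous_on_subset[OF contF, of "{-u..u}"] by auto
  qed
  define g where "g = inv F"
  have Fg: "F (g y) = y" for y
    unfolding g_def using surjF by (metis surj_def surj_f_inv_f)
  have iff: "g y \<le> x \<longleftrightarrow> y \<le> F x" for x y
    using grow[of "g y" x] grow[of x "g y"] Fg[of y] by linarith
  have "1-lipschitz_on UNIV g"
  proof (rule lipschitz_onI)
    fix x y
    show "dist (g x) (g y) \<le> 1 * dist x y"
      using grow[of "g x" "g y"] grow[of "g y" "g x"] Fg[of x] Fg[of y]
      by (auto simp: dist_real_def abs_if split: if_splits)
  qed simp
  then have [measurable]: "g \<in> borel_measurable borel"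
    by (intro borel_measurable_continuous_onI lipschitz_on_continuous_on)
  define M where "M = distr lborel borel g"
  have setsM: "sets M = sets lborel" by (simp add: M_def)
  have emM: "emeasure M {a<..b} = ennreal (F b - F a)" if "a \<le> b" for a b
  proof -
    have "emeasure M {a<..b} = emeasure lborel (g -` {a<..b})"
      by (simp add: M_def emeasure_distr)
    also have "g -` {a<..b} = {F a<..F b}"
      using iff by (auto simp: not_le[symmetric])
    finally show ?thesis using grow[OF that] that by simp
  qed
  have ac: "absolutely_continuous lborel M"
    unfolding absolutely_continuous_def
  proof
    fix X :: "real set" assume X: "X \<in> null_sets lborel"
    have "negligible (F ` X)"
    proof (rule negligible_locally_Lipschitz_image)
      show "negligible X" using X by (simp add: negligible_iff_null_sets null_sets_completionI)
      show "\<exists>U B. open U \<and> x \<in> U \<and> (\<forall>y\<in>X \<inter> U. norm (F y - F x) \<le> B * norm (y - x))" if "x \<in> X" for x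
      proof (intro exI[of _ UNIV] exI[of _ "2 * L + 1"] conjI ballI)
        fix y
        have "F y - F x = (L + 1) * (y - x) + (f y - f x)" by (simp add: F_def algebra_simps)
        moreover have "\<bar>(L + 1) * (y - x)\<bar> = (L + 1) * \<bar>y - x\<bar>" using L0 by (simp add: abs_mult)
        ultimately have "\<bar>F y - F x\<bar> \<le> (L + 1) * \<bar>y - x\<bar> + \<bar>f y - f x\<bar>"
          using abs_triangle_ineq[of "(L + 1) * (y - x)" "f y - f x"] by linarith
        then show "norm (F y - F x) \<le> (2 * L + 1) * norm (y - x)"
          using fdist[of y x] by (simp add: algebra_simps)
      qed auto
    qed simp
    moreover have "F ` X = g -` X"
    proof -
      have "g (F x) = x" for x
        using iff[of "F x" x] grow[of "g (F x)" x] Fg[of "F x"] by auto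
      then show ?thesis using Fg by (auto simp: image_iff) (metis Fg)
    qed
    ultimately have "emeasure lebesgue (g -` X) = 0"
      by (metis negligible_iff_emeasure0 negligible_imp_sets)
    moreover have "g -` X \<in> sets borel"
      using measurable_sets[of g borel borel X] X by (auto simp: null_sets_def)
    ultimately show "X \<in> null_sets M"
      using X by (auto simp: null_sets_def M_def emeasure_distr)
  qed
  obtain d where d[measurable]: "d \<in> borel_measurable borel" and dM: "density lborel d = M"
    using sigma_finite_measure.Radon_Nikodym[OF sigma_finite_lborel ac setsM] by auto
  have emd: "(\<integral>\<^sup>+x\<in>{a<..b}. d x \<partial>lborel) = ennreal (F b - F a)" if "a \<le> b" for a b
    using emM[OF that] by (simp add: dM[symmetric] emeasure_density mult.commute)
  \<comment> \<open>The image measure is only locally finite, hence the exhaustion by bounded intervals.\<close>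
  have fin: "AE x in lborel. d x \<noteq> \<infinity>"
  proof -
    have "AE x in lborel. \<forall>n::nat. x \<in> {- real n<..real n} \<longrightarrow> d x \<noteq> \<infinity>"
    proof (subst AE_all_countable, rule allI)
      fix n
      have "AE x in lborel. d x * indicator {- real n<..real n} x \<noteq> \<infinity>"
        by (rule nn_integral_PInf_AE) (simp_all add: emd)
      then show "AE x in lborel. x \<in> {- real n<..real n} \<longrightarrow> d x \<noteq> \<infinity>"
        by eventually_elim auto
    qed
    then show ?thesis
    proof eventually_elim
      case (elim x)
      obtain n :: nat where "\<bar>x\<bar> < n" using reals_Archimedean2 by blast
      then have "x \<in> {- real n<..real n}" by auto
      then show ?case using elim by blast
    qed
  qed
  define k where "k x = enn2real (d x)" for x
  have kF: "(k has_integral (F b - F a)) {a..b}" if "a \<le> b" for a b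
  proof -
    have "(\<integral>\<^sup>+x. ennreal (k x * indicator {a<..b} x) \<partial>lborel) = (\<integral>\<^sup>+x\<in>{a<..b}. d x \<partial>lborel)"
      using fin by (intro nn_integral_cong_AE, eventually_elim)
        (auto simp: k_def less_top indicator_def)
    then have "((\<lambda>x. k x * indicator {a<..b} x) has_integral (F b - F a)) UNIV"
      using grow[OF that] that
      by (intro nn_integral_has_integral) (auto simp: emd k_def)
    also have "(\<lambda>x. k x * indicator {a<..b} x) = (\<lambda>x. if x \<in> {a<..b} then k x else 0)"
      by (auto simp: indicator_def)
    finally have "(k has_integral (F b - F a)) {a<..b}"
      by (simp only: has_integral_restrict_UNIV)
    moreover have "negligible {x \<in> {a..b} - {a<..b}. k x \<noteq> 0}"
      by (rule negligible_subset[of "{a}"]) auto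
    moreover have "negligible {x \<in> {a<..b} - {a..b}. k x \<noteq> 0}"
      by (rule negligible_subset[of "{a}"]) auto
    ultimately show ?thesis
      using has_integral_spike_set_eq[of "{a<..b}" "{a..b}" k] by blast
  qed
  show thesis
  proof (rule that)
    fix a b :: real assume "a \<le> b"
    have "((\<lambda>x. k x - (L + 1)) has_integral (F b - F a) - (b - a) *\<^sub>R (L + 1)) {a..b}"
      using \<open>a \<le> b\<close> has_integral_const_real[of "L+1" a b]
      by (intro has_integral_diff kF) auto
    then show "((\<lambda>x. k x - (L + 1)) has_integral (f b - f a)) {a..b}"
      by (simp add: F_def algebra_simps)
  qed
qed

text \<open>
  Lebesgue's differentiation theorem enters here in the form that averages over
  \<open>[x, x + t]\<close> converge for almost all \<open>x\<close>, which says nothing about left derivatives.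
\<close>

lemma right_derivative_of_primitive:
  fixes f h :: "real \<Rightarrow> real"
  assumes h: "\<And>a b. a \<le> b \<Longrightarrow> (h has_integral (f b - f a)) {a..b}"
  obtains N where "negligible N"
    "\<And>x. x \<notin> N \<Longrightarrow> (f has_real_derivative h x) (at_right x)"
proof -
  have "h integrable_on cbox a b" for a b
    using h[of a b] by (cases "a \<le> b") (auto simp: has_integral_integrable)
  from integrable_ccontinuous_explicit[OF this]
  obtain N where N: "negligible N" and
    lim: "\<And>x e. \<lbrakk>x \<notin> N; 0 < e\<rbrakk> \<Longrightarrow> \<exists>d>0. \<forall>t. 0 < t \<and> t < d \<longrightarrow>
            norm (integral (cbox x (x + t *\<^sub>R One)) h /\<^sub>R t ^ DIM(real) - h x) < e"
    by blast
  show thesis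
  proof (rule that[OF N])
    fix x assume x: "x \<notin> N"
    show "(f has_real_derivative h x) (at_right x)"
      unfolding has_field_derivative_iff tendsto_iff
    proof (intro allI impI)
      fix e :: real assume "0 < e"
      obtain d where "d > 0" and d: "\<And>t. 0 < t \<Longrightarrow> t < d \<Longrightarrow>
          norm (integral (cbox x (x + t *\<^sub>R One)) h /\<^sub>R t ^ DIM(real) - h x) < e"
        using lim[OF x \<open>0 < e\<close>] by blast
      have "dist ((f y - f x) / (y - x)) (h x) < e" if "x < y" "y < x + d" for y
        using d[of "y - x"] that integral_unique[OF h[of x y]]
        by (simp add: dist_norm divide_inverse mult.commute)
      then show "\<forall>\<^sub>F y in at_right x. dist ((f y - f x) / (y - x)) (h x) < e"
        unfolding eventually_at_right_field using \<open>d > 0\<close> by (intro exI[of _ "x + d"]) auto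
    qed
  qed
qed

lemma negligible_uminus_image:
  fixes N :: "real set"
  assumes "negligible N"
  shows "negligible (uminus ` N)"
  by (rule negligible_differentiable_image_negligible[OF order_refl assms])
     (auto intro!: derivative_intros simp: differentiable_on_def)

text \<open>
  The left derivative of \<open>f\<close> at \<open>x\<close> is the right derivative of \<open>\<lambda>x. - f (- x)\<close> at \<open>- x\<close>, so
  the one-sided result is applied to both functions.
\<close>

theorem primitive_derivative_AE:
  fixes f h :: "real \<Rightarrow> real"
  assumes h: "\<And>a b. a \<le> b \<Longrightarrow> (h has_integral (f b - f a)) {a..b}"
  obtains N where "negligible N"
    "\<And>x. x \<notin> N \<Longrightarrow> (f has_real_derivative h x) (at x)"
proof -
  obtain N where N: "negligible N" "\<And>x. x \<notin> N \<Longrightarrow> (f has_real_derivative h x) (at_right x)"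
    using right_derivative_of_primitive[OF h] by blast
  have "((\<lambda>x. h (- x)) has_integral (- f (- b) - - f (- a))) {a..b}" if "a \<le> b" for a b
    using has_integral_reflect_real[of h "f (- a) - f (- b)" "- a" "- b"] h[of "- b" "- a"] that
    by simp
  then obtain N' where N': "negligible N'"
    "\<And>x. x \<notin> N' \<Longrightarrow> ((\<lambda>x. - f (- x)) has_real_derivative h (- x)) (at_right x)"
    using right_derivative_of_primitive[of "\<lambda>x. h (- x)" "\<lambda>x. - f (- x)"] by blast
  show thesis
  proof (rule that[of "N \<union> uminus ` N'"])
    show "negligible (N \<union> uminus ` N')"
      using N(1) N'(1) by (simp add: negligible_uminus_image)
    fix x assume x: "x \<notin> N \<union> uminus ` N'"
    then have "- x \<notin> N'" by (metis UnI2 imageI minus_minus)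
    from N'(2)[OF this]
    have "((\<lambda>y. (- f (- y) + f x) / (y + x)) \<longlongrightarrow> h x) (at_right (- x))"
      by (simp add: has_field_derivative_iff)
    then have "((\<lambda>y. (- f y + f x) / (- y + x)) \<longlongrightarrow> h x) (at_left x)"
      by (simp add: at_left_minus filterlim_filtermap add.commute)
    moreover have "(- f y + f x) / (- y + x) = (f y - f x) / (y - x)" for y
      by (metis add.commute add_uminus_conv_diff minus_diff_eq minus_divide_divide)
    ultimately have "((\<lambda>y. (f y - f x) / (y - x)) \<longlongrightarrow> h x) (at_left x)" by simp
    moreover have "((\<lambda>y. (f y - f x) / (y - x)) \<longlongrightarrow> h x) (at_right x)"
      using N(2) x by (simp add: has_field_derivative_iff)
    ultimately show "(f has_real_derivative h x) (at x)"
      by (simp add: has_field_derivative_iff filterlim_split_at)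
  qed
qed

text \<open>
  The function is extended constantly beyond the interval, which keeps its Lipschitz constant
  and its germs at interior points.
\<close>

lemma lipschitz_real_derivative_AE:
  fixes f :: "real \<Rightarrow> real"
  assumes lip: "L-lipschitz_on {a..b} f" and ab: "a \<le> b"
  obtains N h where "negligible N" "(h has_integral (f b - f a)) {a..b}"
    "\<And>x. x \<in> {a<..<b} - N \<Longrightarrow> (f has_real_derivative h x) (at x)"
proof -
  define F where "F x = f (max a (min b x))" for x
  have "L-lipschitz_on UNIV F"
  proof (rule lipschitz_onI)
    fix x y
    have "dist (F x) (F y) \<le> L * dist (max a (min b x)) (max a (min b y))"
      unfolding F_def using ab by (intro lipschitz_onD[OF lip]) auto
    also have "\<dots> \<le> L * dist x y"
      using lipschitz_on_nonneg[OF lip] by (intro mult_left_mono) (auto simp: dist_real_def)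
    finally show "dist (F x) (F y) \<le> L * dist x y" .
  qed (rule lipschitz_on_nonneg[OF lip])
  then obtain h where h: "\<And>a b. a \<le> b \<Longrightarrow> (h has_integral (F b - F a)) {a..b}"
    using lipschitz_real_primitive by blast
  obtain N where N: "negligible N" "\<And>x. x \<notin> N \<Longrightarrow> (F has_real_derivative h x) (at x)"
    using primitive_derivative_AE[OF h] by blast
  show thesis
  proof (rule that[OF N(1)])
    show "(h has_integral (f b - f a)) {a..b}"
      using h[OF ab] ab by (simp add: F_def)
    fix x assume x: "x \<in> {a<..<b} - N"
    show "(f has_real_derivative h x) (at x)"
      by (rule has_field_derivative_transform_within_open[of F _ _ "{a<..<b}"])
         (use N(2)[of x] x in \<open>auto simp: F_def\<close>)
  qed
qed

lemma lipschitz_derivative_bound: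
  fixes f :: "real \<Rightarrow> 'a::real_normed_vector"
  assumes lip: "L-lipschitz_on {a..b} f" and x: "x \<in> {a<..<b}"
    and D: "(f has_vector_derivative D) (at x)"
  shows "norm D \<le> L"
proof -
  let ?r = "\<lambda>y. norm (f y - f x - (y - x) *\<^sub>R D) / norm (y - x)"
  have "\<forall>\<^sub>F y in at x. y \<in> {a<..<b} - {x}"
    using x by (intro eventually_at_in_open) auto
  then have "\<forall>\<^sub>F y in at x. norm D - L \<le> ?r y"
  proof eventually_elim
    case (elim y)
    have "norm (f y - f x) \<le> L * \<bar>y - x\<bar>"
      using lipschitz_onD[OF lip, of y x] elim x by (simp add: dist_norm)
    then have "norm D * \<bar>y - x\<bar> \<le> L * \<bar>y - x\<bar> + norm (f y - f x - (y - x) *\<^sub>R D)"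
      using norm_triangle_ineq3[of "f y - f x" "(y - x) *\<^sub>R D"] by (simp add: mult.commute)
    then show ?case using elim by (simp add: field_simps)
  qed
  moreover have "(?r \<longlongrightarrow> 0) (at x)"
    using D by (simp add: has_vector_derivative_def has_derivative_iff_norm)
  ultimately have "norm D - L \<le> 0"
    by (intro tendsto_lowerbound[of ?r 0 "at x"]) auto
  then show ?thesis by simp
qed

theorem lipschitz_vector_derivative_AE:
  fixes f :: "real \<Rightarrow> 'a::euclidean_space"
  assumes lip: "L-lipschitz_on {a..b} f" and ab: "a \<le> b"
  obtains N h where "negligible N" "(h has_integral (f b - f a)) {a..b}"
    "\<And>x. x \<in> {a<..<b} - N \<Longrightarrow> (f has_vector_derivative h x) (at x)"
proof -
  have "\<exists>N h. negligible N \<and> (h has_integral (f b \<bullet> i - f a \<bullet> i)) {a..b} \<and>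
          (\<forall>x \<in> {a<..<b} - N. ((\<lambda>x. f x \<bullet> i) has_real_derivative h x) (at x))"
    if "i \<in> Basis" for i
  proof -
    have "L-lipschitz_on {a..b} (\<lambda>x. f x \<bullet> i)"
    proof (rule lipschitz_onI)
      fix x y assume "x \<in> {a..b}" "y \<in> {a..b}"
      then have "norm (f x - f y) \<le> L * dist x y"
        using lipschitz_onD[OF lip] by (simp add: dist_norm)
      then show "dist (f x \<bullet> i) (f y \<bullet> i) \<le> L * dist x y"
        using Basis_le_norm[OF that, of "f x - f y"] by (simp add: dist_norm inner_diff_left)
    qed (rule lipschitz_on_nonneg[OF lip])
    then show ?thesis using lipschitz_real_derivative_AE[OF _ ab] by metis
  qed
  then obtain N h where N: "\<And>i. i \<in> Basis \<Longrightarrow> negligible (N i)"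
    and h: "\<And>i. i \<in> Basis \<Longrightarrow> (h i has_integral (f b \<bullet> i - f a \<bullet> i)) {a..b}"
    and D: "\<And>i x. i \<in> Basis \<Longrightarrow> x \<in> {a<..<b} - N i \<Longrightarrow>
              ((\<lambda>x. f x \<bullet> i) has_real_derivative h i x) (at x)"
    by metis
  define g where "g x = (\<Sum>i\<in>Basis. h i x *\<^sub>R i)" for x
  show thesis
  proof (rule that[of "\<Union>i\<in>Basis. N i" g])
    show "negligible (\<Union>i\<in>Basis. N i)" using N by (intro negligible_Union) auto
    show "(g has_integral (f b - f a)) {a..b}"
      unfolding has_integral_componentwise_iff[of g] g_def using h by (simp add: inner_diff_left)
    fix x assume "x \<in> {a<..<b} - (\<Union>i\<in>Basis. N i)"
    then show "(f has_vector_derivative g x) (at x)"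
      unfolding has_vector_derivative_def has_derivative_componentwise_within[of f] g_def
      using D by (auto simp: has_field_derivative_def mult_commute_abs)
  qed
qed

text \<open>
  The derivative of a Lipschitz function is bounded wherever it exists, which makes the
  integral absolutely convergent. The function \<open>f'\<close> is arbitrary on the exceptional null set, as
  \<open>vector_derivative\<close> may be.
\<close>

theorem lipschitz_FTC:
  fixes f :: "real \<Rightarrow> 'a::euclidean_space"
  assumes lip: "L-lipschitz_on {a..b} f" and ab: "a \<le> b" and N: "negligible N"
    and D: "\<And>x. x \<in> {a<..<b} - N \<Longrightarrow> (f has_vector_derivative f' x) (at x)"
  shows "(f' has_integral (f b - f a)) {a..b}" and "f' absolutely_integrable_on {a..b}"
proof -
  obtain N0 h where N0: "negligible N0" and h: "(h has_integral (f b - f a)) {a..b}"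
    and Dh: "\<And>x. x \<in> {a<..<b} - N0 \<Longrightarrow> (f has_vector_derivative h x) (at x)"
    using lipschitz_vector_derivative_AE[OF lip ab] by blast
  have neg: "negligible (N \<union> N0 \<union> {a, b})" using N N0 by simp
  have eq: "f' x = h x" if "x \<in> {a..b} - (N \<union> N0 \<union> {a, b})" for x
    using that by (intro vector_derivative_unique_at[OF D Dh]) auto
  show *: "(f' has_integral (f b - f a)) {a..b}"
    by (rule has_integral_spike[OF neg eq h])
  define g where "g x = (if x \<in> {a<..<b} - N then f' x else 0)" for x
  have g: "(g has_integral (f b - f a)) {a..b}"
    by (rule has_integral_spike[OF neg _ *]) (auto simp: g_def)
  have "g absolutely_integrable_on {a..b}"
  proof (intro measurable_bounded_by_integrable_imp_absolutely_integrable)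
    show "norm (g x) \<le> L" for x
    proof (cases "x \<in> {a<..<b} - N")
      case True
      then have "norm (f' x) \<le> L"
        by (intro lipschitz_derivative_bound[OF lip _ D[OF True]]) simp
      then show ?thesis using True by (simp add: g_def)
    next
      case False
      then have "g x = 0" unfolding g_def by (rule if_not_P)
      then show ?thesis using lipschitz_on_nonneg[OF lip] by simp
    qed
    show "g \<in> borel_measurable (lebesgue_on {a..b})"
      using g by (intro integrable_imp_measurable has_integral_integrable)
  qed auto
  then show "f' absolutely_integrable_on {a..b}"
    by (rule absolutely_integrable_spike[OF _ neg]) (auto simp: g_def)
qed

section \<open>Radial growth and weighted length of Lipschitz curves\<close>

lemma negligible_nonzero_of_integral_zero:
  fixes f :: "'a::euclidean_space \<Rightarrow> real"
  assumes f: "f absolutely_integrable_on S" and nn: "\<And>x. x \<in> S \<Longrightarrow> 0 \<le> f x"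
    and zero: "(f has_integral 0) S"
  shows "negligible {x \<in> S. f x \<noteq> 0}"
proof -
  have "(LINT x:S|lebesgue. f x) = 0"
    using set_lebesgue_integral_eq_integral(2)[OF f] integral_unique[OF zero] by simp
  then have "AE x in lebesgue. indicator S x *\<^sub>R f x = 0"
    using f nn unfolding set_lebesgue_integral_def set_integrable_def
    by (subst (asm) integral_nonneg_eq_0_iff_AE) (auto simp: indicator_def)
  then show ?thesis
    by (auto simp: eventually_ae_filter negligible_iff_null_sets indicator_def
        intro: negligible_subset elim!: completion.complete2[rotated])
qed

text \<open>
  The mean value theorem needs differentiability only in the open interval, so the
  endpoint 0, where the real power is awkward, does no harm.
\<close>

lemma lipschitz_powr:
  fixes p B :: real
  assumes "1 \<le> p" "0 \<le> B"
  shows "(p * B powr (p - 1))-lipschitz_on {0..B} (\<lambda>x. x powr p)"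
proof (rule lipschitz_on_leI)
  fix x y :: real assume xy: "x \<in> {0..B}" "y \<in> {0..B}" "x \<le> y"
  show "dist (x powr p) (y powr p) \<le> p * B powr (p - 1) * dist x y"
  proof (cases "x < y")
    case True
    have "\<exists>l z. x < z \<and> z < y \<and> DERIV (\<lambda>x. x powr p) z :> l \<and> y powr p - x powr p = (y - x) * l"
    proof (rule MVT[OF True])
      show "continuous_on {x..y} (\<lambda>x. x powr p)"
        using xy assms by (intro continuous_on_powr' continuous_intros) auto
      show "(\<lambda>x. x powr p) differentiable (at z)" if "x < z" "z < y" for z
        using that xy by (auto intro!: derivative_intros simp: real_differentiable_def)
          (use has_real_derivative_powr[of z p] that xy in auto)
    qed
    then obtain l z where z: "x < z" "z < y" "DERIV (\<lambda>x. x powr p) z :> l"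
      and eq: "y powr p - x powr p = (y - x) * l" by blast
    have "l = p * z powr (p - 1)"
      using z xy by (intro DERIV_unique[OF z(3) has_real_derivative_powr]) auto
    moreover have "z powr (p - 1) \<le> B powr (p - 1)"
      using z xy assms by (intro powr_mono2) auto
    ultimately have "0 \<le> l" "l \<le> p * B powr (p - 1)"
      using assms by (auto intro: mult_left_mono)
    then show ?thesis
      using True eq mult_left_mono[of l "p * B powr (p - 1)" "y - x"]
      by (simp add: dist_real_def abs_minus_commute[of "x powr p"] abs_mult mult.commute)
  next
    case False
    then show ?thesis using xy by simp
  qed
qed (use assms in auto)

lemma has_real_derivative_norm_curve:
  fixes \<gamma> :: "real \<Rightarrow> 'a::real_inner"
  assumes D: "(\<gamma> has_vector_derivative D) (at t)" and nz: "\<gamma> t \<noteq> 0"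
  shows "((\<lambda>s. norm (\<gamma> s)) has_real_derivative (\<gamma> t \<bullet> D / norm (\<gamma> t))) (at t)"
proof -
  have "((\<lambda>s. norm (\<gamma> s)) has_derivative (\<lambda>h. (h *\<^sub>R D) \<bullet> sgn (\<gamma> t))) (at t)"
    using has_derivative_compose[OF D[unfolded has_vector_derivative_def] has_derivative_norm[OF nz]] .
  then show ?thesis
    by (simp add: has_field_derivative_def sgn_div_norm inner_commute divide_inverse mult_commute_abs mult.commute mult.left_commute)
qed

lemma locally_lipschitz_on_Icc:
  assumes "locally_lipschitz_on {a..b} \<gamma>"
  obtains L where "L-lipschitz_on {a..b} \<gamma>"
  using local_lipschitz_compact_implies_lipschitz[of "{0::real}" "{a..b}" "\<lambda>_. \<gamma>"] assms
  unfolding locally_lipschitz_on_def by auto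

lemma lipschitz_vector_derivative_within:
  fixes f :: "real \<Rightarrow> 'a::euclidean_space"
  assumes lip: "L-lipschitz_on {a..b} f" and ab: "a < b"
  obtains N where "negligible N"
    "\<And>t. t \<in> {a<..<b} - N \<Longrightarrow>
       (f has_vector_derivative vector_derivative f (at t within {a..b})) (at t)"
proof -
  obtain N h where N: "negligible N" and h: "(h has_integral (f b - f a)) {a..b}"
    and D: "\<And>x. x \<in> {a<..<b} - N \<Longrightarrow> (f has_vector_derivative h x) (at x)"
    using lipschitz_vector_derivative_AE[OF lip less_imp_le[OF ab]] by blast
  show thesis
  proof (rule that[OF N])
    fix t assume t: "t \<in> {a<..<b} - N"
    then have "vector_derivative f (at t within {a..b}) = h t"
      using ab by (intro vector_derivative_at_within_ivl D) auto
    then show "(f has_vector_derivative vector_derivative f (at t within {a..b})) (at t)"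
      using D[OF t] by simp
  qed
qed

text \<open>
  The distance from \<open>p\<close> to the origin in the metric with conformal factor \<open>|p|^q\<close>; it
  calibrates the radial segments.
\<close>

definition radial_primitive :: "real \<Rightarrow> 'a::real_normed_vector \<Rightarrow> real" where
  "radial_primitive q p = norm p powr (q + 1) / (q + 1)"

text \<open>
  At a time when the curve is at the origin the radial function is minimal, so a
  derivative that exists there is 0. The formula on the right agrees because \<open>x / 0 = 0\<close>.
\<close>

lemma radial_primitive_derivative_eq:
  fixes \<gamma> :: "real \<Rightarrow> 'a::real_inner"
  assumes q: "0 < q" and D: "(\<gamma> has_vector_derivative D) (at t)"
    and G: "((\<lambda>s. radial_primitive q (\<gamma> s)) has_real_derivative G) (at t)"
  shows "G = norm (\<gamma> t) powr q * (\<gamma> t \<bullet> D / norm (\<gamma> t))"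
proof (cases "\<gamma> t = 0")
  case True
  have "G = 0"
    by (rule DERIV_local_min[OF G zero_less_one]) (use q True in \<open>auto simp: radial_primitive_def\<close>)
  then show ?thesis using True by simp
next
  case False
  have "((\<lambda>s. norm (\<gamma> s) powr (q + 1) / (q + 1)) has_real_derivative
          norm (\<gamma> t) powr q * (\<gamma> t \<bullet> D / norm (\<gamma> t))) (at t)"
    using q False
    by (auto intro!: derivative_eq_intros DERIV_fun_powr[OF has_real_derivative_norm_curve[OF D False], of "q + 1", THEN DERIV_cong])
  then show ?thesis using G unfolding radial_primitive_def by (rule DERIV_unique[OF _ , symmetric])
qed

lemma lipschitz_radial_primitive:
  fixes \<gamma> :: "real \<Rightarrow> 'a::real_normed_vector"
  assumes lip: "L-lipschitz_on {a..b} \<gamma>" and q: "0 < q"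
  obtains M where "M-lipschitz_on {a..b} (\<lambda>t. radial_primitive q (\<gamma> t))"
proof -
  have "compact (\<gamma> ` {a..b})"
    using lipschitz_on_continuous_on[OF lip] by (intro compact_continuous_image) auto
  then obtain B where B: "0 < B" "\<And>t. t \<in> {a..b} \<Longrightarrow> norm (\<gamma> t) \<le> B"
    using compact_imp_bounded bounded_pos by (metis imageI)
  have "L-lipschitz_on {a..b} (\<lambda>t. norm (\<gamma> t))"
  proof (rule lipschitz_onI)
    fix x y assume "x \<in> {a..b}" "y \<in> {a..b}"
    then show "dist (norm (\<gamma> x)) (norm (\<gamma> y)) \<le> L * dist x y"
      using lipschitz_onD[OF lip, of x y] norm_triangle_ineq3[of "\<gamma> x" "\<gamma> y"]
      by (simp add: dist_norm)
  qed (rule lipschitz_on_nonneg[OF lip])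
  moreover have "((q + 1) * B powr (q + 1 - 1))-lipschitz_on ((\<lambda>t. norm (\<gamma> t)) ` {a..b}) (\<lambda>x. x powr (q + 1))"
    using B q by (intro lipschitz_on_subset[OF lipschitz_powr]) auto
  ultimately have "((q + 1) * B powr (q + 1 - 1) * L)-lipschitz_on {a..b} (\<lambda>t. norm (\<gamma> t) powr (q + 1))"
    by (rule lipschitz_on_compose2)
  from lipschitz_on_cmult_real[OF this, of "1 / (q + 1)"]
  show thesis by (intro that) (simp add: radial_primitive_def[abs_def])
qed

lemma radial_speed_has_integral:
  fixes \<gamma> :: "real \<Rightarrow> 'a::euclidean_space" and a b :: real
  defines "v t \<equiv> vector_derivative \<gamma> (at t within {a..b})"
  assumes lip: "L-lipschitz_on {a..b} \<gamma>" and ab: "a < b" and q: "0 < q"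
    and cd: "a \<le> c" "c \<le> d" "d \<le> b"
  shows "((\<lambda>t. norm (\<gamma> t) powr q * (\<gamma> t \<bullet> v t / norm (\<gamma> t))) has_integral
            radial_primitive q (\<gamma> d) - radial_primitive q (\<gamma> c)) {c..d}"
    and "(\<lambda>t. norm (\<gamma> t) powr q * (\<gamma> t \<bullet> v t / norm (\<gamma> t))) absolutely_integrable_on {c..d}"
proof -
  obtain M where "M-lipschitz_on {a..b} (\<lambda>t. radial_primitive q (\<gamma> t))"
    using lipschitz_radial_primitive[OF lip q] by blast
  then have M: "M-lipschitz_on {c..d} (\<lambda>t. radial_primitive q (\<gamma> t))"
    by (rule lipschitz_on_subset) (use cd in auto)
  obtain N1 h where N1: "negligible N1" and "(h has_integral
      (radial_primitive q (\<gamma> d) - radial_primitive q (\<gamma> c))) {c..d}"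
    and h: "\<And>t. t \<in> {c<..<d} - N1 \<Longrightarrow>
              ((\<lambda>t. radial_primitive q (\<gamma> t)) has_vector_derivative h t) (at t)"
    by (rule lipschitz_vector_derivative_AE[OF M cd(2)]) (rule that)
  obtain N2 where N2: "negligible N2"
    and v: "\<And>t. t \<in> {a<..<b} - N2 \<Longrightarrow> (\<gamma> has_vector_derivative v t) (at t)"
    using lipschitz_vector_derivative_within[OF lip ab] unfolding v_def by blast
  have N: "negligible (N1 \<union> N2)" using N1 N2 by simp
  have D: "((\<lambda>t. radial_primitive q (\<gamma> t)) has_vector_derivative
           norm (\<gamma> t) powr q * (\<gamma> t \<bullet> v t / norm (\<gamma> t))) (at t)"
    if t: "t \<in> {c<..<d} - (N1 \<union> N2)" for t
  proof -
    have "h t = norm (\<gamma> t) powr q * (\<gamma> t \<bullet> v t / norm (\<gamma> t))"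
      using t cd h[of t]
      by (intro radial_primitive_derivative_eq[OF q v])
         (auto simp: has_real_derivative_iff_has_vector_derivative)
    then show ?thesis using h[of t] t by simp
  qed
  show "((\<lambda>t. norm (\<gamma> t) powr q * (\<gamma> t \<bullet> v t / norm (\<gamma> t))) has_integral
            radial_primitive q (\<gamma> d) - radial_primitive q (\<gamma> c)) {c..d}"
    by (rule lipschitz_FTC(1)[OF M cd(2) N D])
  show "(\<lambda>t. norm (\<gamma> t) powr q * (\<gamma> t \<bullet> v t / norm (\<gamma> t))) absolutely_integrable_on {c..d}"
    by (rule lipschitz_FTC(2)[OF M cd(2) N D])
qed

lemma weighted_speed_absolutely_integrable:
  fixes \<gamma> :: "real \<Rightarrow> 'a::euclidean_space" and a b :: real
  defines "v t \<equiv> vector_derivative \<gamma> (at t within {a..b})"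
  assumes lip: "L-lipschitz_on {a..b} \<gamma>" and ab: "a < b" and q: "0 < q"
  shows "(\<lambda>t. norm (\<gamma> t) powr q * norm (v t)) absolutely_integrable_on {a..b}"
proof -
  obtain N where N: "negligible N"
    and v: "\<And>t. t \<in> {a<..<b} - N \<Longrightarrow> (\<gamma> has_vector_derivative v t) (at t)"
    using lipschitz_vector_derivative_within[OF lip ab] unfolding v_def by blast
  have "v absolutely_integrable_on {a..b}"
    by (rule lipschitz_FTC(2)[OF lip less_imp_le[OF ab] N v])
  from absolutely_integrable_norm[OF this] have nv: "(\<lambda>t. norm (v t)) absolutely_integrable_on {a..b}"
    by (simp add: o_def)
  have cont: "continuous_on {a..b} (\<lambda>t. norm (\<gamma> t) powr q)"
    using lipschitz_on_continuous_on[OF lip] q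
    by (intro continuous_on_powr' continuous_intros) auto
  show ?thesis
  proof (rule absolutely_integrable_bounded_measurable_product_real[OF _ _ _ nv])
    show "(\<lambda>t. norm (\<gamma> t) powr q) \<in> borel_measurable (lebesgue_on {a..b})"
      by (rule continuous_imp_measurable_on_sets_lebesgue[OF cont]) simp
    show "bounded ((\<lambda>t. norm (\<gamma> t) powr q) ` {a..b})"
      using compact_continuous_image[OF cont] compact_imp_bounded by blast
  qed simp
qed

section \<open>The lower bound and its equality case\<close>

lemma sgn_lipschitz_estimate:
  fixes x y :: "'a::real_normed_vector"
  assumes c: "0 < c" "c \<le> norm x" and y: "y \<noteq> 0"
  shows "norm (sgn x - sgn y) \<le> 2 / c * norm (x - y)"
proof -
  have x: "x \<noteq> 0" using c by auto
  have "sgn x - sgn y = (norm y *\<^sub>R (x - y) + (norm y - norm x) *\<^sub>R y) /\<^sub>R (norm x * norm y)"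
    using x y by (simp add: sgn_div_norm algebra_simps divide_simps)
  also have "norm \<dots> \<le> (norm y * norm (x - y) + \<bar>norm y - norm x\<bar> * norm y) / (norm x * norm y)"
    using norm_triangle_ineq[of "norm y *\<^sub>R (x - y)" "(norm y - norm x) *\<^sub>R y"]
    by (simp add: divide_inverse mult.commute mult_left_mono)
  also have "\<dots> \<le> (norm y * norm (x - y) + norm (x - y) * norm y) / (norm x * norm y)"
    using norm_triangle_ineq3[of y x] by (intro divide_right_mono add_left_mono mult_right_mono)
      (auto simp: norm_minus_commute)
  also have "\<dots> = 2 * norm (x - y) / norm x" using x y by (simp add: field_simps)
  also have "\<dots> \<le> 2 * norm (x - y) / c" using c x by (intro divide_left_mono mult_pos_pos) auto
  finally show ?thesis by simp
qed

text \<open>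
  The rate of weighted length minus the rate at which the radial function decreases, at the
  point \<open>p\<close> with velocity \<open>w\<close>.
\<close>

definition length_defect :: "real \<Rightarrow> 'a::real_inner \<Rightarrow> 'a \<Rightarrow> real" where
  "length_defect q p w = norm p powr q * norm w + norm p powr q * (p \<bullet> w / norm p)"

lemma length_defect_nonneg: "0 \<le> length_defect q p w"
proof (cases "p = 0")
  case False
  then have "- norm w \<le> p \<bullet> w / norm p"
    using Cauchy_Schwarz_ineq2[of p w] by (simp add: field_simps)
  then have "0 \<le> norm p powr q * (norm w + p \<bullet> w / norm p)" by simp
  then show ?thesis by (simp add: length_defect_def algebra_simps)
qed (simp add: length_defect_def)

text \<open>
  A vanishing defect is equality in Cauchy--Schwarz for \<open>- p\<close> and \<open>w\<close>: the velocity points to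
  the origin.
\<close>

lemma length_defect_zeroD:
  assumes "length_defect q p w = 0" "p \<noteq> 0"
  shows "p \<bullet> w / norm p = - norm w" and "norm p *\<^sub>R w = - (norm w *\<^sub>R p)"
proof -
  have "norm p powr q * (norm w + p \<bullet> w / norm p) = 0"
    using assms(1) by (simp add: length_defect_def algebra_simps)
  then show *: "p \<bullet> w / norm p = - norm w" using assms(2) by simp
  then have "(- p) \<bullet> w = norm (- p) * norm w" using assms(2) by (simp add: field_simps)
  then show "norm p *\<^sub>R w = - (norm w *\<^sub>R p)"
    unfolding norm_cauchy_schwarz_eq by simp
qed

lemma length_defect_has_integral:
  fixes \<gamma> :: "real \<Rightarrow> real \<times> real"
  defines "v t \<equiv> vector_derivative \<gamma> (at t within {0..1})"
  assumes \<gamma>: "\<gamma> \<in> curves_to_origin p" and q: "0 < q"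
  shows "((\<lambda>t. length_defect q (\<gamma> t) (v t)) has_integral weighted_length q \<gamma> - radial_primitive q p) {0..1}"
    and "(\<lambda>t. length_defect q (\<gamma> t) (v t)) absolutely_integrable_on {0..1}"
proof -
  obtain L where L: "L-lipschitz_on {0..1} \<gamma>"
    using \<gamma> locally_lipschitz_on_Icc unfolding curves_to_origin_def by blast
  have w: "(\<lambda>t. norm (\<gamma> t) powr q * norm (v t)) absolutely_integrable_on {0..1}"
    unfolding v_def by (rule weighted_speed_absolutely_integrable[OF L zero_less_one q])
  note r = radial_speed_has_integral[OF L zero_less_one q, of 0 1, folded v_def]
  show "(\<lambda>t. length_defect q (\<gamma> t) (v t)) absolutely_integrable_on {0..1}"
    unfolding length_defect_def by (intro set_integral_add(1) w r) auto
  have "((\<lambda>t. norm (\<gamma> t) powr q * norm (v t)) has_integral weighted_length q \<gamma>) {0..1}"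
    using set_lebesgue_integral_eq_integral[OF w] 
    by (simp add: weighted_length_def v_def has_integral_iff)
  moreover have "radial_primitive q (\<gamma> 1) - radial_primitive q (\<gamma> 0) = - radial_primitive q p"
    using \<gamma> by (simp add: radial_primitive_def curves_to_origin_def zero_prod_def[symmetric])
  ultimately show "((\<lambda>t. length_defect q (\<gamma> t) (v t)) has_integral weighted_length q \<gamma> - radial_primitive q p) {0..1}"
    unfolding length_defect_def using has_integral_add[OF _ r(1)] by fastforce
qed

theorem weighted_length_ge:
  assumes "\<gamma> \<in> curves_to_origin p" "0 < q"
  shows "radial_primitive q p \<le> weighted_length q \<gamma>"
  using has_integral_nonneg[OF length_defect_has_integral(1)[OF assms]] length_defect_nonneg by fastforce

text \<open>
  Minimality forces the defect to vanish almost everywhere. Then \<open>|\<gamma>|\<close> is nonincreasing,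
  so up to time \<open>b\<close> the curve keeps a positive distance from the origin. On \<open>[0, b]\<close> the
  direction \<open>\<gamma>/|\<gamma>|\<close> is thus Lipschitz, and its derivative is 0 almost everywhere.
\<close>

theorem weighted_length_eq_imp_radial:
  fixes \<gamma> :: "real \<Rightarrow> real \<times> real"
  assumes \<gamma>: "\<gamma> \<in> curves_to_origin p" and q: "0 < q"
    and eq: "weighted_length q \<gamma> = radial_primitive q p"
    and b: "b \<in> {0<..1}" "\<gamma> b \<noteq> 0"
  shows "sgn (\<gamma> b) = sgn p"
proof -
  define v where "v t = vector_derivative \<gamma> (at t within {0..1})" for t
  obtain L where L: "L-lipschitz_on {0..1} \<gamma>"
    using \<gamma> locally_lipschitz_on_Icc unfolding curves_to_origin_def by blast
  define Z where "Z = {t \<in> {0..1}. length_defect q (\<gamma> t) (v t) \<noteq> 0}"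
  have Z: "negligible Z"
    unfolding Z_def v_def
    using length_defect_has_integral[OF \<gamma> q] eq length_defect_nonneg
    by (intro negligible_nonzero_of_integral_zero) auto
  have mono: "norm (\<gamma> b) \<le> norm (\<gamma> s)" if s: "s \<in> {0..b}" for s
  proof -
    have "((\<lambda>t. norm (\<gamma> t) powr q * (\<gamma> t \<bullet> v t / norm (\<gamma> t))) has_integral
            radial_primitive q (\<gamma> b) - radial_primitive q (\<gamma> s)) {s..b}"
      unfolding v_def using s b by (intro radial_speed_has_integral(1)[OF L zero_less_one q]) auto
    then have "((\<lambda>t. - (norm (\<gamma> t) powr q * norm (v t))) has_integral
            radial_primitive q (\<gamma> b) - radial_primitive q (\<gamma> s)) {s..b}"
      by (rule has_integral_spike[OF Z, rotated]) (use s b in \<open>auto simp: Z_def length_defect_def\<close>)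
    from has_integral_le[OF this has_integral_0]
    have "radial_primitive q (\<gamma> b) - radial_primitive q (\<gamma> s) \<le> 0" by simp
    then have "norm (\<gamma> b) powr (q + 1) \<le> norm (\<gamma> s) powr (q + 1)"
      using q by (simp add: radial_primitive_def divide_le_cancel)
    then show ?thesis
      using q powr_less_mono2[of "q + 1" "norm (\<gamma> s)" "norm (\<gamma> b)"] by fastforce
  qed
  let ?c = "norm (\<gamma> b)"
  have c: "0 < ?c" using b by simp
  have nz: "\<gamma> s \<noteq> 0" if "s \<in> {0..b}" for s using mono[OF that] c by auto
  have lip: "(2 / ?c * L)-lipschitz_on {0..b} (\<lambda>t. sgn (\<gamma> t))"
  proof (rule lipschitz_onI)
    fix x y assume xy: "x \<in> {0..b}" "y \<in> {0..b}"
    have "dist (sgn (\<gamma> x)) (sgn (\<gamma> y)) \<le> 2 / ?c * dist (\<gamma> x) (\<gamma> y)"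
      unfolding dist_norm using xy by (intro sgn_lipschitz_estimate c mono nz)
    also have "\<dots> \<le> 2 / ?c * (L * dist x y)"
      using xy b c by (intro mult_left_mono lipschitz_onD[OF L]) auto
    finally show "dist (sgn (\<gamma> x)) (sgn (\<gamma> y)) \<le> 2 / ?c * L * dist x y" by (simp add: mult.assoc)
  qed (use lipschitz_on_nonneg[OF L] c in auto)
  obtain N where N: "negligible N"
    and v: "\<And>t. t \<in> {0<..<1} - N \<Longrightarrow> (\<gamma> has_vector_derivative v t) (at t)"
    using lipschitz_vector_derivative_within[OF L zero_less_one] unfolding v_def by blast
  have "((\<lambda>t. 0) has_integral sgn (\<gamma> b) - sgn (\<gamma> 0)) {0..b}"
  proof (rule lipschitz_FTC(1)[OF lip])
    show "negligible (N \<union> Z)" using N Z by simp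
    fix t assume t: "t \<in> {0<..<b} - (N \<union> Z)"
    have D: "(\<gamma> has_vector_derivative v t) (at t)" and nzt: "\<gamma> t \<noteq> 0"
      using v nz t b by auto
    have Z0: "length_defect q (\<gamma> t) (v t) = 0" using t b by (auto simp: Z_def)
    note zd = length_defect_zeroD[OF Z0 nzt]
    have "((\<lambda>s. inverse (norm (\<gamma> s))) has_real_derivative norm (v t) / (norm (\<gamma> t))\<^sup>2) (at t)"
      using DERIV_inverse_fun[OF has_real_derivative_norm_curve[OF D nzt]] nzt unfolding zd(1)
      by (simp add: divide_inverse power2_eq_square mult_ac)
    from has_vector_derivative_scaleR[OF this D]
    have "((\<lambda>s. sgn (\<gamma> s)) has_vector_derivative
        (inverse (norm (\<gamma> t)) *\<^sub>R v t + (norm (v t) / (norm (\<gamma> t))\<^sup>2) *\<^sub>R \<gamma> t)) (at t)"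
      by (simp add: sgn_div_norm)
    also have "inverse (norm (\<gamma> t)) *\<^sub>R v t + (norm (v t) / (norm (\<gamma> t))\<^sup>2) *\<^sub>R \<gamma> t
        = (norm (\<gamma> t) *\<^sub>R v t + norm (v t) *\<^sub>R \<gamma> t) /\<^sub>R (norm (\<gamma> t))\<^sup>2"
      using nzt by (simp add: scaleR_add_right power2_eq_square field_simps)
    also have "\<dots> = 0" using zd(2) by simp
    finally show "((\<lambda>s. sgn (\<gamma> s)) has_vector_derivative 0) (at t)" .
  qed (use b in auto)
  then show ?thesis using \<gamma> by (simp add: curves_to_origin_def)
qed

section \<open>A segment followed by small circles\<close>

lemma lipschitz_on_of_vector_derivative_bound:
  fixes f :: "real \<Rightarrow> 'a::real_normed_vector"
  assumes D: "\<And>x. x \<in> X \<Longrightarrow> (f has_vector_derivative f' x) (at x within X)" and X: "convex X"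
    and B: "\<And>x. x \<in> X \<Longrightarrow> norm (f' x) \<le> B" "0 \<le> B"
  shows "B-lipschitz_on X f"
proof (rule bounded_derivative_imp_lipschitz[OF _ X _ B(2)])
  fix x assume x: "x \<in> X"
  show "(f has_derivative (\<lambda>h. h *\<^sub>R f' x)) (at x within X)"
    using D[OF x] by (simp add: has_vector_derivative_def)
  show "onorm (\<lambda>h. h *\<^sub>R f' x) \<le> B"
    using B(2) mult_left_mono[OF B(1)[OF x] abs_ge_zero]
    by (intro onorm_bound) (simp_all add: mult.commute)
qed

text \<open>
  A circle of radius \<open>\<rho>\<close> with centre \<open>(\<rho>, 0)\<close>, which starts at the origin at \<open>s = 0\<close>.
  The factor \<open>\<kappa>\<close> is 1 or -1 for the two orientations; the value 0, which \<open>sgn\<close> takes at 0, goes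
  with radius 0.
\<close>

definition circle :: "real \<Rightarrow> real \<Rightarrow> real \<Rightarrow> real \<Rightarrow> real \<times> real" where
  "circle \<rho> \<kappa> \<omega> s = (\<rho> * (1 - cos (\<omega> * s)), \<kappa> * \<rho> * sin (\<omega> * s))"

lemma circle_derivative:
  "(circle \<rho> \<kappa> \<omega> has_vector_derivative
     (\<rho> * \<omega> * sin (\<omega> * s), \<kappa> * \<rho> * \<omega> * cos (\<omega> * s))) (at s within X)"
  unfolding circle_def[abs_def]
  by (intro has_vector_derivative_Pair)
     (auto simp flip: has_real_derivative_iff_has_vector_derivative intro!: derivative_eq_intros)

lemma norm_circle_le:
  assumes "0 \<le> \<rho>" "\<bar>\<kappa>\<bar> \<le> 1"
  shows "norm (circle \<rho> \<kappa> \<omega> s) \<le> 2 * \<rho>"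
proof -
  let ?c = "cos (\<omega> * s)" and ?s = "sin (\<omega> * s)"
  have "\<kappa>\<^sup>2 * ?s\<^sup>2 \<le> 1 * ?s\<^sup>2"
    using assms by (intro mult_right_mono) (auto simp: abs_square_le_1)
  moreover have "(1 - ?c)\<^sup>2 + ?s\<^sup>2 = 2 - 2 * ?c"
    using sin_cos_squared_add[of "\<omega> * s"] by (simp add: power2_eq_square algebra_simps)
  moreover have "- 1 \<le> ?c" by simp
  ultimately have "(1 - ?c)\<^sup>2 + \<kappa>\<^sup>2 * ?s\<^sup>2 \<le> 4" by linarith
  then have "\<rho>\<^sup>2 * ((1 - ?c)\<^sup>2 + \<kappa>\<^sup>2 * ?s\<^sup>2) \<le> \<rho>\<^sup>2 * 4"
    by (intro mult_left_mono) auto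
  then have "(\<rho> * (1 - ?c))\<^sup>2 + (\<kappa> * \<rho> * ?s)\<^sup>2 \<le> (2 * \<rho>)\<^sup>2"
    by (simp add: power_mult_distrib distrib_left mult_ac)
  then show ?thesis
    using assms by (simp add: circle_def norm_prod_def real_le_lsqrt)
qed

lemma norm_circle_derivative_le:
  assumes "0 \<le> \<rho>" "\<bar>\<kappa>\<bar> \<le> 1" "0 \<le> \<omega>"
  shows "norm (\<rho> * \<omega> * sin x, \<kappa> * \<rho> * \<omega> * cos x) \<le> \<rho> * \<omega>"
proof -
  have "\<kappa>\<^sup>2 * (cos x)\<^sup>2 \<le> 1 * (cos x)\<^sup>2"
    using assms by (intro mult_right_mono) (auto simp: abs_square_le_1)
  then have "(sin x)\<^sup>2 + \<kappa>\<^sup>2 * (cos x)\<^sup>2 \<le> 1"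
    using sin_cos_squared_add[of x] by linarith
  then have "(\<rho> * \<omega>)\<^sup>2 * ((sin x)\<^sup>2 + \<kappa>\<^sup>2 * (cos x)\<^sup>2) \<le> (\<rho> * \<omega>)\<^sup>2 * 1"
    by (intro mult_left_mono) auto
  then have "(\<rho> * \<omega> * sin x)\<^sup>2 + (\<kappa> * \<rho> * \<omega> * cos x)\<^sup>2 \<le> (\<rho> * \<omega>)\<^sup>2"
    by (simp add: power_mult_distrib algebra_simps)
  then show ?thesis
    using assms by (simp add: norm_prod_def real_le_lsqrt)
qed

text \<open>
  The two truncated times let each summand rest at the origin while the other one moves, so
  that the Lipschitz property follows without gluing at time 1/2.
\<close>

definition segment_then_circle :: "real \<Rightarrow> real \<Rightarrow> real \<Rightarrow> real \<Rightarrow> real \<times> real" where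
  "segment_then_circle \<rho> \<kappa> \<omega> t = (max 0 (1 - 2 * t), 0) + circle \<rho> \<kappa> \<omega> (max 0 (2 * t - 1))"

lemma segment_then_circle_simps:
  "t \<le> 1/2 \<Longrightarrow> segment_then_circle \<rho> \<kappa> \<omega> t = (1 - 2 * t, 0)"
  "1/2 \<le> t \<Longrightarrow> segment_then_circle \<rho> \<kappa> \<omega> t = circle \<rho> \<kappa> \<omega> (2 * t - 1)"
  by (auto simp: segment_then_circle_def circle_def)

lemma segment_then_circle_derivative:
  "t < 1/2 \<Longrightarrow> (segment_then_circle \<rho> \<kappa> \<omega> has_vector_derivative (-2, 0)) (at t)"
  "1/2 < t \<Longrightarrow> (segment_then_circle \<rho> \<kappa> \<omega> has_vector_derivative
     2 *\<^sub>R (\<rho> * \<omega> * sin (\<omega> * (2 * t - 1)), \<kappa> * \<rho> * \<omega> * cos (\<omega> * (2 * t - 1)))) (at t)"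
proof -
  have "((\<lambda>t. (1 - 2 * t, 0)) has_vector_derivative (-2, 0::real)) (at t)"
    by (intro has_vector_derivative_Pair)
       (auto simp flip: has_real_derivative_iff_has_vector_derivative intro!: derivative_eq_intros)
  then show "(segment_then_circle \<rho> \<kappa> \<omega> has_vector_derivative (-2, 0)) (at t)" if "t < 1/2"
    by (rule has_vector_derivative_transform_within_open[of _ _ _ "{..<1/2}"])
       (use that in \<open>auto simp: segment_then_circle_simps\<close>)
  have "((\<lambda>t. 2 * t - 1) has_vector_derivative 2) (at t)"
    by (auto simp flip: has_real_derivative_iff_has_vector_derivative intro!: derivative_eq_intros)
  from vector_diff_chain_at[OF this circle_derivative]
  have "((\<lambda>t. circle \<rho> \<kappa> \<omega> (2 * t - 1)) has_vector_derivative
     2 *\<^sub>R (\<rho> * \<omega> * sin (\<omega> * (2 * t - 1)), \<kappa> * \<rho> * \<omega> * cos (\<omega> * (2 * t - 1)))) (at t)"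
    by (simp add: o_def)
  then show "(segment_then_circle \<rho> \<kappa> \<omega> has_vector_derivative
     2 *\<^sub>R (\<rho> * \<omega> * sin (\<omega> * (2 * t - 1)), \<kappa> * \<rho> * \<omega> * cos (\<omega> * (2 * t - 1)))) (at t)" if "1/2 < t"
    by (rule has_vector_derivative_transform_within_open[of _ _ _ "{1/2<..}"])
       (use that in \<open>auto simp: segment_then_circle_simps\<close>)
qed

lemma segment_then_circle_lipschitz:
  assumes "0 \<le> \<rho>" "\<bar>\<kappa>\<bar> \<le> 1" "0 \<le> \<omega>"
  shows "(2 + \<rho> * \<omega> * 2)-lipschitz_on X (segment_then_circle \<rho> \<kappa> \<omega>)"
proof -
  have segment: "2-lipschitz_on X (\<lambda>t. (max 0 (1 - 2 * t), 0::real))"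
  proof (rule lipschitz_onI)
    fix x y :: real
    have "\<bar>max 0 (1 - 2 * x) - max 0 (1 - 2 * y)\<bar> \<le> 2 * \<bar>x - y\<bar>" by (auto simp: max_def abs_if)
    then show "dist (max 0 (1 - 2 * x), 0::real) (max 0 (1 - 2 * y), 0) \<le> 2 * dist x y"
      by (simp add: dist_Pair_Pair dist_real_def)
  qed simp
  have circle: "(\<rho> * \<omega>)-lipschitz_on UNIV (circle \<rho> \<kappa> \<omega>)"
    using assms
    by (intro lipschitz_on_of_vector_derivative_bound[OF circle_derivative] norm_circle_derivative_le) auto
  have "2-lipschitz_on X (\<lambda>t. max 0 (2 * t - 1))"
  proof (rule lipschitz_onI)
    fix x y :: real
    show "dist (max 0 (2 * x - 1)) (max 0 (2 * y - 1)) \<le> 2 * dist x y"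
      by (auto simp: dist_real_def max_def abs_if)
  qed simp
  from lipschitz_on_add[OF segment lipschitz_on_compose2[OF this lipschitz_on_subset[OF circle subset_UNIV]]]
  show ?thesis
    unfolding segment_then_circle_def[abs_def] .
qed

lemma segment_then_circle_curve:
  assumes "0 \<le> \<rho>" "\<bar>\<kappa>\<bar> \<le> 1" "0 \<le> \<omega>" "cos \<omega> = 1"
  shows "segment_then_circle \<rho> \<kappa> \<omega> \<in> curves_to_origin (1, 0)"
proof -
  have "sin \<omega> = 0" using assms(4) sin_cos_squared_add[of \<omega>] by simp
  moreover have "locally_lipschitz_on {0..1} (segment_then_circle \<rho> \<kappa> \<omega>)"
    unfolding locally_lipschitz_on_iff using segment_then_circle_lipschitz[OF assms(1-3)] zero_less_one by blast
  ultimately show ?thesis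
    using assms(4) by (simp add: curves_to_origin_def segment_then_circle_simps circle_def)
qed

text \<open>
  Only the second half contributes, and there the integrand is a multiple of \<open>sin\<^sup>2\<close>. Its
  primitive vanishes at time 1/2 and so extends continuously by 0 to the first half.
\<close>

lemma area_segment_then_circle:
  assumes "cos \<omega> = 1" "0 \<le> \<omega>"
  shows "area_functional (segment_then_circle \<rho> \<kappa> \<omega>) = - (\<kappa> * \<rho>\<^sup>2 * \<omega> / 2)"
proof -
  let ?\<gamma> = "segment_then_circle \<rho> \<kappa> \<omega>"
  have sin: "sin \<omega> = 0" using assms(1) sin_cos_squared_add[of \<omega>] by simp
  define \<phi> where "\<phi> t = \<omega> * max 0 (2 * t - 1)" for t
  define F where "F t = \<rho>\<^sup>2 / 2 * (\<phi> t - sin (\<phi> t) * cos (\<phi> t))" for t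
  define f where "f t = (if t \<le> 1/2 then 0 else 2 * \<omega> * \<rho>\<^sup>2 * (sin (\<phi> t))\<^sup>2)" for t
  have "(f has_integral F 1 - F 0) {0..1}"
  proof (rule fundamental_theorem_of_calculus_interior_strong[of "{1/2}"])
    show "continuous_on {0..1} F"
      unfolding F_def \<phi>_def by (intro continuous_intros)
    fix t :: real assume t: "t \<in> {0<..<1} - {1/2}"
    show "(F has_vector_derivative f t) (at t)"
    proof (cases "t < 1/2")
      case True
      show ?thesis
        by (rule has_vector_derivative_transform_within_open[of "\<lambda>_. 0" _ _ "{..<1/2}"])
           (use True in \<open>auto simp: F_def \<phi>_def f_def\<close>)
    next
      case False
      let ?F = "\<lambda>t. \<rho>\<^sup>2 / 2 * (\<omega> * (2 * t - 1) - sin (\<omega> * (2 * t - 1)) * cos (\<omega> * (2 * t - 1)))"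
      have "((\<lambda>t. \<omega> * (2 * t - 1) - sin (\<omega> * (2 * t - 1)) * cos (\<omega> * (2 * t - 1))) has_real_derivative
          2 * \<omega> - 2 * \<omega> * (cos (\<omega> * (2 * t - 1)))\<^sup>2 + 2 * \<omega> * (sin (\<omega> * (2 * t - 1)))\<^sup>2) (at t)"
        by (auto intro!: derivative_eq_intros simp: power2_eq_square algebra_simps)
      from DERIV_cmult[OF this, of "\<rho>\<^sup>2 / 2"]
      have "(?F has_vector_derivative f t) (at t)"
        using False t
        by (simp add: f_def \<phi>_def cos_squared_eq max_def has_real_derivative_iff_has_vector_derivative algebra_simps)
      then show ?thesis
        by (rule has_vector_derivative_transform_within_open[of _ _ _ "{1/2<..}"])
           (use False t in \<open>auto simp: F_def \<phi>_def\<close>)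
    qed
  qed auto
  then have f: "(f has_integral \<rho>\<^sup>2 * \<omega> / 2) {0..1}"
    by (simp add: F_def \<phi>_def sin)
  have "f absolutely_integrable_on {0..1}"
    using f assms(2) by (intro nonnegative_absolutely_integrable_1) (auto simp: f_def)
  then have \<kappa>f: "(\<lambda>t. \<kappa> * f t) absolutely_integrable_on {0..1}" by simp
  have eq: "snd (?\<gamma> t) * vector_derivative (\<lambda>s. fst (?\<gamma> s)) (at t within {0..1}) = \<kappa> * f t"
    if t: "t \<in> {0..1} - {0, 1/2, 1}" for t
  proof (cases "t < 1/2")
    case True
    then show ?thesis by (simp add: segment_then_circle_simps f_def)
  next
    case False
    then have "((\<lambda>s. fst (?\<gamma> s)) has_vector_derivative 2 * (\<rho> * \<omega> * sin (\<omega> * (2 * t - 1)))) (at t)"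
      using t bounded_linear.has_vector_derivative[OF bounded_linear_fst segment_then_circle_derivative(2)[of t]] by simp
    then have "vector_derivative (\<lambda>s. fst (?\<gamma> s)) (at t within {0..1}) = 2 * (\<rho> * \<omega> * sin (\<omega> * (2 * t - 1)))"
      using t by (intro vector_derivative_at_within_ivl) auto
    then show ?thesis using False t
      by (simp add: segment_then_circle_simps circle_def f_def \<phi>_def power2_eq_square)
  qed
  have ai: "(\<lambda>t. snd (?\<gamma> t) * vector_derivative (\<lambda>s. fst (?\<gamma> s)) (at t within {0..1})) absolutely_integrable_on {0..1}"
    by (rule absolutely_integrable_spike[OF \<kappa>f, of "{0, 1/2, 1}"]) (simp, rule eq)
  have "((\<lambda>t. snd (?\<gamma> t) * vector_derivative (\<lambda>s. fst (?\<gamma> s)) (at t within {0..1}))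
          has_integral \<kappa> * (\<rho>\<^sup>2 * \<omega> / 2)) {0..1}"
    by (rule has_integral_spike[of "{0, 1/2, 1}", OF _ eq has_integral_mult_right[OF f]]) auto
  then show ?thesis
    unfolding area_functional_def set_lebesgue_integral_eq_integral(2)[OF ai]
    by (simp add: integral_unique)
qed

lemma weighted_length_segment_then_circle:
  assumes "0 \<le> \<rho>" "\<bar>\<kappa>\<bar> \<le> 1" "0 \<le> \<omega>" and q: "0 < q"
  shows "weighted_length q (segment_then_circle \<rho> \<kappa> \<omega>) \<le> 1 / (1 + q) + (2 * \<rho>) powr q * (\<rho> * \<omega>)"
proof -
  let ?\<gamma> = "segment_then_circle \<rho> \<kappa> \<omega>"
  define f where "f t = norm (?\<gamma> t) powr q * norm (vector_derivative ?\<gamma> (at t within {0..1}))" for t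
  have ai: "f absolutely_integrable_on {0..1}"
    unfolding f_def using weighted_speed_absolutely_integrable[OF segment_then_circle_lipschitz[OF assms(1-3)] zero_less_one q] .
  then have int: "f integrable_on {0..1}" by (rule set_lebesgue_integral_eq_integral(1))
  have "weighted_length q ?\<gamma> = integral {0..1} f"
    using set_lebesgue_integral_eq_integral(2)[OF ai] by (simp add: weighted_length_def f_def)
  also have "\<dots> = integral {0..1/2} f + integral {1/2..1} f"
    by (rule Henstock_Kurzweil_Integration.integral_combine[symmetric]) (use int in auto)
  also have "integral {0..1/2} f = 1 / (1 + q)"
  proof -
    let ?P = "\<lambda>t. - ((1 - 2 * t) powr (q + 1) / (q + 1))"
    have "(f has_integral ?P (1/2) - ?P 0) {0..1/2}"
    proof (rule fundamental_theorem_of_calculus_interior)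
      show "continuous_on {0..1/2} ?P"
        using q by (intro continuous_intros continuous_on_powr') auto
      fix t :: real assume t: "t \<in> {0<..<1/2}"
      have "vector_derivative ?\<gamma> (at t within {0..1}) = (-2, 0)"
        using t by (intro vector_derivative_at_within_ivl segment_then_circle_derivative) auto
      then have "f t = (1 - 2 * t) powr q * 2"
        using t by (simp add: f_def segment_then_circle_simps norm_prod_def)
      moreover have "((\<lambda>t. (1 - 2 * t) powr (q + 1)) has_real_derivative (q + 1) * (1 - 2 * t) powr q * - 2) (at t)"
        using t by (auto intro!: derivative_eq_intros)
      from DERIV_cmult[OF this, of "- 1 / (q + 1)"]
      have "(?P has_real_derivative (1 - 2 * t) powr q * 2) (at t)"
        using q by simp
      ultimately show "(?P has_vector_derivative f t) (at t)"
        by (simp add: has_real_derivative_iff_has_vector_derivative)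
    qed auto
    then show ?thesis by (simp add: integral_unique add.commute)
  qed
  also have "integral {1/2..1} f \<le> (2 * \<rho>) powr q * (\<rho> * \<omega>)"
  proof -
    have "f integrable_on {1/2..1}"
      by (rule integrable_on_subinterval[OF int]) auto
    then have "(f has_integral integral {1/2..1} f) (cbox (1/2) 1)"
      by (simp add: has_integral_integral)
    moreover have "norm (f t) \<le> (2 * \<rho>) powr q * (2 * (\<rho> * \<omega>))"
      if t: "t \<in> cbox (1/2) 1 - {1/2, 1}" for t
    proof -
      let ?D = "2 *\<^sub>R (\<rho> * \<omega> * sin (\<omega> * (2 * t - 1)), \<kappa> * \<rho> * \<omega> * cos (\<omega> * (2 * t - 1)))"
      have "vector_derivative ?\<gamma> (at t within {0..1}) = ?D"
        using t by (intro vector_derivative_at_within_ivl segment_then_circle_derivative) auto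
      moreover have "norm ?D \<le> 2 * (\<rho> * \<omega>)"
        using norm_circle_derivative_le[OF assms(1-3)] by (simp only: norm_scaleR) simp
      moreover have "norm (?\<gamma> t) \<le> 2 * \<rho>"
        using t norm_circle_le[OF assms(1,2)] by (simp add: segment_then_circle_simps)
      then have "norm (?\<gamma> t) powr q \<le> (2 * \<rho>) powr q"
        using q by (intro powr_mono2) auto
      ultimately show ?thesis
        unfolding f_def using assms by (auto simp: abs_mult intro!: mult_mono)
    qed
    ultimately have "norm (integral {1/2..1} f) \<le> (2 * \<rho>) powr q * (2 * (\<rho> * \<omega>)) * measure lborel (cbox (1/2) (1::real))"
      using assms by (intro has_integral_bound_spike_finite[of _ "{1/2, 1}"]) auto
    then show ?thesis by simp
  qed
  finally show ?thesis by simp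
qed

section \<open>The infimum\<close>

text \<open>
  The radius is chosen such that \<open>n\<close> turns enclose the area \<open>|A|\<close>, counted with multiplicity.
  The cost of the turns is then at most \<open>4 |A| (2 \<rho>)^(q-1)\<close>, because the weight is at most
  \<open>(2 \<rho>)^q\<close> on the circle.
\<close>

theorem cheap_curve_with_area:
  fixes q A e :: real
  assumes q: "1 < q" and e: "0 < e"
  obtains \<gamma> where "\<gamma> \<in> constrained_curves A (1, 0)" "weighted_length q \<gamma> < 1 / (1 + q) + e"
proof -
  define \<rho> where "\<rho> n = sqrt (\<bar>A\<bar> / (pi * real n))" for n
  have nonneg: "0 \<le> \<rho> n" for n by (simp add: \<rho>_def)
  have "(\<lambda>n. \<bar>A\<bar> / pi * (1 / real n)) \<longlonglongrightarrow> \<bar>A\<bar> / pi * 0"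
    by (intro tendsto_intros lim_1_over_n)
  then have "\<rho> \<longlonglongrightarrow> 0"
    unfolding \<rho>_def using tendsto_real_sqrt by fastforce
  then have "(\<lambda>n. 4 * \<bar>A\<bar> * (2 * \<rho> n) powr (q - 1)) \<longlonglongrightarrow> 4 * \<bar>A\<bar> * (2 * 0) powr (q - 1)"
    using q nonneg by (intro tendsto_intros) auto
  then have "(\<lambda>n. 4 * \<bar>A\<bar> * (2 * \<rho> n) powr (q - 1)) \<longlonglongrightarrow> 0"
    using q by simp
  then have "\<forall>\<^sub>F n in sequentially. 4 * \<bar>A\<bar> * (2 * \<rho> n) powr (q - 1) < e"
    using e by (rule order_tendstoD)
  then have "\<forall>\<^sub>F n in sequentially. 4 * \<bar>A\<bar> * (2 * \<rho> n) powr (q - 1) < e \<and> 0 < n"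
    using eventually_gt_at_top[of 0] by eventually_elim simp
  then obtain n where n: "4 * \<bar>A\<bar> * (2 * \<rho> n) powr (q - 1) < e" "0 < n"
    using eventually_happens trivial_limit_sequentially by blast
  define \<omega> where "\<omega> = 2 * pi * real n"
  \<comment> \<open>The area is minus the integral of the second coordinate against the first, hence \<open>- sgn A\<close>.\<close>
  define \<gamma> where "\<gamma> = segment_then_circle (\<rho> n) (- sgn A) \<omega>"
  note \<rho> = nonneg[of n]
  have \<omega>: "0 \<le> \<omega>" "cos \<omega> = 1"
    using cos_int_2pin[of "int n"] by (simp_all add: \<omega>_def mult_ac)
  have \<kappa>: "\<bar>- sgn A\<bar> \<le> 1" by (simp add: sgn_if)
  have sq: "(\<rho> n)\<^sup>2 * \<omega> = 2 * \<bar>A\<bar>"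
    using n(2) by (simp add: \<rho>_def \<omega>_def field_simps)
  have "area_functional \<gamma> = sgn A * ((\<rho> n)\<^sup>2 * \<omega>) / 2"
    unfolding \<gamma>_def using area_segment_then_circle[OF \<omega>(2,1)] by simp
  also have "\<dots> = A" unfolding sq by (simp add: sgn_mult_abs)
  finally have "\<gamma> \<in> constrained_curves A (1, 0)"
    using segment_then_circle_curve[OF \<rho> \<kappa> \<omega>] by (simp add: constrained_curves_def \<gamma>_def)
  moreover have "(2 * \<rho> n) powr q * (\<rho> n * \<omega>) = 4 * \<bar>A\<bar> * (2 * \<rho> n) powr (q - 1)"
  proof (cases "\<rho> n = 0")
    case True
    then show ?thesis by simp
  next
    case False
    then have "(2 * \<rho> n) powr q = (2 * \<rho> n) powr (q - 1) * (2 * \<rho> n)"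
      using \<rho> powr_add[of "2 * \<rho> n" "q - 1" 1] by simp
    then have "(2 * \<rho> n) powr q * (\<rho> n * \<omega>) = 2 * (2 * \<rho> n) powr (q - 1) * ((\<rho> n)\<^sup>2 * \<omega>)"
      by (simp add: power2_eq_square mult_ac)
    then show ?thesis unfolding sq by simp
  qed
  then have "weighted_length q \<gamma> < 1 / (1 + q) + e"
    using weighted_length_segment_then_circle[OF \<rho> \<kappa> \<omega>(1), of q] q n(1) by (simp add: \<gamma>_def)
  ultimately show thesis by (rule that)
qed

text \<open>
  The lower bound holds for all curves to the origin and the cheap curves have the
  prescribed area, so every class between the two has the same infimum.
\<close>

lemma INF_weighted_length:
  assumes q: "1 < q" and S: "constrained_curves A (1, 0) \<subseteq> S" "S \<subseteq> curves_to_origin (1, 0)"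
  shows "(INF \<gamma>\<in>S. weighted_length q \<gamma>) = 1 / (1 + q)"
proof (rule cInf_eq_non_empty)
  show "weighted_length q ` S \<noteq> {}"
    using cheap_curve_with_area[OF q zero_less_one, of A] S by blast
  show "1 / (1 + q) \<le> x" if "x \<in> weighted_length q ` S" for x
    using that S(2) weighted_length_ge[of _ "(1, 0)" q] q by (auto simp: radial_primitive_def add.commute)
  show "y \<le> 1 / (1 + q)" if lower: "\<And>x. x \<in> weighted_length q ` S \<Longrightarrow> y \<le> x" for y
  proof (rule field_le_epsilon)
    fix e :: real assume "0 < e"
    then obtain \<gamma> where "\<gamma> \<in> constrained_curves A (1, 0)" "weighted_length q \<gamma> < 1 / (1 + q) + e"
      using cheap_curve_with_area[OF q] by blast
    then show "y \<le> 1 / (1 + q) + e"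
      using lower[of "weighted_length q \<gamma>"] S(1) by auto
  qed
qed

theorem mainTheorem10:
  fixes q A :: real and p\<^sub>0 :: "real \<times> real"
  assumes "q > 1" and "p\<^sub>0 = (1, 0)"
  shows "(INF \<gamma>\<in>constrained_curves A p\<^sub>0. weighted_length q \<gamma>)
           = (INF \<gamma>\<in>curves_to_origin p\<^sub>0. weighted_length q \<gamma>)
       \<and> (INF \<gamma>\<in>curves_to_origin p\<^sub>0. weighted_length q \<gamma>) = 1 / (1 + q)
       \<and> (A \<noteq> 0 \<longrightarrow>
            \<not> (\<exists>\<gamma>\<in>constrained_curves A p\<^sub>0.
                 \<forall>\<eta>\<in>constrained_curves A p\<^sub>0. weighted_length q \<gamma> \<le> weighted_length q \<eta>))"
proof (intro conjI impI notI)
  have sub: "constrained_curves A (1, 0) \<subseteq> curves_to_origin (1, 0)"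
    by (auto simp: constrained_curves_def)
  show inf: "(INF \<gamma>\<in>curves_to_origin p\<^sub>0. weighted_length q \<gamma>) = 1 / (1 + q)"
    unfolding assms(2) using assms(1) sub by (intro INF_weighted_length[of q A]) auto
  show "(INF \<gamma>\<in>constrained_curves A p\<^sub>0. weighted_length q \<gamma>)
           = (INF \<gamma>\<in>curves_to_origin p\<^sub>0. weighted_length q \<gamma>)"
    unfolding inf unfolding assms(2) using assms(1) sub by (intro INF_weighted_length[of q A]) auto
  assume A: "A \<noteq> 0" and "\<exists>\<gamma>\<in>constrained_curves A p\<^sub>0.
                 \<forall>\<eta>\<in>constrained_curves A p\<^sub>0. weighted_length q \<gamma> \<le> weighted_length q \<eta>"
  then obtain \<gamma> where \<gamma>: "\<gamma> \<in> curves_to_origin (1, 0)" and area: "area_functional \<gamma> = A"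
    and min: "\<And>\<eta>. \<eta> \<in> constrained_curves A (1, 0) \<Longrightarrow> weighted_length q \<gamma> \<le> weighted_length q \<eta>"
    using assms(2) by (auto simp: constrained_curves_def)
  have "weighted_length q \<gamma> \<le> 1 / (1 + q)"
  proof (rule field_le_epsilon)
    fix e :: real assume "0 < e"
    then obtain \<eta> where "\<eta> \<in> constrained_curves A (1, 0)" "weighted_length q \<eta> < 1 / (1 + q) + e"
      using cheap_curve_with_area[OF assms(1)] by blast
    then show "weighted_length q \<gamma> \<le> 1 / (1 + q) + e"
      using min[of \<eta>] by linarith
  qed
  then have eq: "weighted_length q \<gamma> = radial_primitive q (1::real, 0::real)"
    using weighted_length_ge[OF \<gamma>, of q] assms(1) by (simp add: radial_primitive_def add.commute)
  have snd: "snd (\<gamma> t) = 0" if t: "t \<in> {0..1}" for t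
  proof (cases "t = 0 \<or> \<gamma> t = 0")
    case True
    then show ?thesis using \<gamma> by (auto simp: curves_to_origin_def)
  next
    case False
    then have "sgn (\<gamma> t) = sgn (1, 0)"
      using t assms(1) by (intro weighted_length_eq_imp_radial[OF \<gamma> _ eq]) auto
    then have "snd (norm (\<gamma> t) *\<^sub>R sgn (\<gamma> t)) = 0" by (simp add: sgn_div_norm)
    then show ?thesis using False by (simp add: sgn_div_norm)
  qed
  have "area_functional \<gamma> = - (LINT t:{0..1::real}|lebesgue. 0 :: real)"
    unfolding area_functional_def using snd
    by (intro arg_cong[of _ _ uminus] set_lebesgue_integral_cong) auto
  then show False using area A by simp
qed

end
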